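(* Let $\nu$ be a non-degenerate probability measure on $\mathbb{R}$ whose support is bounded from above, and let $B=B(\nu)=\max\{0,\sup\operatorname{supp}(\nu)\}<\infty$. Let $(m_0,m_+)$ be the domain of means of the one-sided Cauchy-Stieltjes kernel family $\mathcal{K}_+(\nu)$. Then $$m_+=B-\frac{1}{G_\nu(B)},$$ where $1/G_\nu(B):=\lim_{z\searrow B}1/G_\nu(z)\in[0,\infty)$ (this limit can be zero).
   Context: Non-degenerate means: not a point mass. $G_\nu(z)=\int\frac{1}{z-x}\,\nu(dx)$ is the Cauchy transform, considered here for real $z>B$. One-sided Cauchy-Stieltjes kernel family: let $\theta_+=1/B(\nu)$ (with $1/0=\infty$), and for $0<\theta<\theta_+$ let $M(\theta)=\int\frac{1}{1-\theta x}\nu(dx)$ and $P_\theta(dx)=\frac{1}{M(\theta)(1-\theta x)}\nu(dx)$. Then $\mathcal{K}_+(\nu)=\{P_\theta:0<\theta<\theta_+\}$. The mean $m(\theta)=\int x\,P_\theta(dx)$ exists, is finite, and is a strictly increasing continuous function on $(0,\theta_+)$; the domain of means $(m_0,m_+)$ is the image of $(0,\theta_+)$ under $\theta\mapsto m(\theta)$, so $m_0=\lim_{\theta\searrow0}m(\theta)\in[-\infty,\infty)$ and $m_+=\lim_{\theta\nearrow\theta_+}m(\theta)$. *)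

theory Defs
  imports "HOL-Probability.Probability"
begin

definition measure_support :: "real measure \<Rightarrow> real set" where
  "measure_support \<nu> = {x. \<forall>U. open U \<longrightarrow> x \<in> U \<longrightarrow> emeasure \<nu> U > 0}"

definition non_degenerate :: "real measure \<Rightarrow> bool" where
  "non_degenerate \<nu> \<longleftrightarrow> (\<nexists>a. \<nu> = return borel a)"

definition upper_B :: "real measure \<Rightarrow> real" where
  "upper_B \<nu> = max 0 (Sup (measure_support \<nu>))"

definition cauchy_transform :: "real measure \<Rightarrow> real \<Rightarrow> real" where
  "cauchy_transform \<nu> z = (LINT x|\<nu>. 1 / (z - x))"

text \<open>In the extended reals \<open>1 / 0 = \<infinity>\<close>, so this is \<open>\<infinity>\<close> when \<open>upper_B \<nu> = 0\<close>.\<close>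

definition theta_plus :: "real measure \<Rightarrow> ereal" where
  "theta_plus \<nu> = 1 / ereal (upper_B \<nu>)"

lemma theta_plus_eq:
  "theta_plus \<nu> = (if upper_B \<nu> = 0 then \<infinity> else ereal (1 / upper_B \<nu>))"
  by (simp add: theta_plus_def one_ereal_def)

definition csk_M :: "real measure \<Rightarrow> real \<Rightarrow> real" where
  "csk_M \<nu> \<theta> = (LINT x|\<nu>. 1 / (1 - \<theta> * x))"

text \<open>For \<open>0 < \<theta> < theta_plus \<nu>\<close> the density is positive on the support of \<open>\<nu>\<close>,
  so truncation of negative values by \<^const>\<open>ennreal\<close> only affects a null set.\<close>

definition csk_measure :: "real measure \<Rightarrow> real \<Rightarrow> real measure" where
  "csk_measure \<nu> \<theta> = density \<nu> (\<lambda>x. ennreal (1 / (csk_M \<nu> \<theta> * (1 - \<theta> * x))))"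

definition csk_family_plus :: "real measure \<Rightarrow> real measure set" where
  "csk_family_plus \<nu> = csk_measure \<nu> ` einterval 0 (theta_plus \<nu>)"

definition csk_mean :: "real measure \<Rightarrow> real \<Rightarrow> real" where
  "csk_mean \<nu> \<theta> = (LINT x|csk_measure \<nu> \<theta>. x)"

definition domain_of_means :: "real measure \<Rightarrow> real set" where
  "domain_of_means \<nu> = csk_mean \<nu> ` einterval 0 (theta_plus \<nu>)"

lemma domain_of_means_family:
  "domain_of_means \<nu> = (\<lambda>P. LINT x|P. x) ` csk_family_plus \<nu>"
  by (simp add: domain_of_means_def csk_family_plus_def csk_mean_def image_image)

text \<open>The domain of means is an open interval whose endpoints may a priori be infinite;
  \<open>m_plus\<close> is its right endpoint. As \<^term>\<open>csk_mean \<nu>\<close> is increasing, this is also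
  its limit as \<open>\<theta>\<close> increases to \<^term>\<open>theta_plus \<nu>\<close>.\<close>

definition m_plus :: "real measure \<Rightarrow> ereal" where
  "m_plus \<nu> = Sup (ereal ` domain_of_means \<nu>)"

end

theory Submission
  imports Defs
begin

text \<open>With \<open>z = 1 / \<theta>\<close> the mean of \<open>P\<^sub>\<theta>\<close> is \<open>z - 1 / G(z)\<close>. Both \<open>1 / G(z)\<close> and \<open>1 / G(z) - z\<close> are
  nondecreasing on \<open>z > B\<close>: the second is the correlation inequality
  \<open>\<integral> f g d\<nu> \<ge> (\<integral> f d\<nu>) (\<integral> g d\<nu>)\<close> for the increasing functions
  \<open>f(x) = 1 / (z - x)\<close> and \<open>g(x) = 1 / (w - x)\<close>. Hence \<open>1 / G\<close> has a limit at \<open>B\<close> and the supremum of the means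
  is attained in the limit \<open>z \<searrow> B\<close>.\<close>

section \<open>One-sided limits and the support of a measure\<close>

lemma tendsto_at_right_Inf:
  fixes f :: "real \<Rightarrow> real"
  assumes mono: "\<And>x y. b < x \<Longrightarrow> x \<le> y \<Longrightarrow> f x \<le> f y"
    and bdd: "bdd_below (f ` {b<..})"
  shows "(f \<longlongrightarrow> Inf (f ` {b<..})) (at_right b)"
proof (rule order_tendstoI)
  fix a assume "a < Inf (f ` {b<..})"
  then have "a < f x" if "b < x" for x
    using cINF_lower[OF bdd, of x] that by auto
  then show "\<forall>\<^sub>F x in at_right b. a < f x"
    by (auto simp: eventually_at_right_field intro: exI[of _ "b + 1"])
next
  fix a assume "Inf (f ` {b<..}) < a"
  then obtain y where "b < y" "f y < a"
    by (subst (asm) cINF_less_iff[OF _ bdd]) auto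
  then have "f x < a" if "b < x" "x < y" for x
    using mono[of x y] that by simp
  then show "\<forall>\<^sub>F x in at_right b. f x < a"
    using \<open>b < y\<close> by (auto simp: eventually_at_right_field)
qed

text \<open>The complement of the support is the union of all open null sets; by Lindelof countably
  many of them already cover it.\<close>

lemma (in real_distribution) AE_in_measure_support: "AE x in M. x \<in> measure_support M"
proof -
  define \<U> where "\<U> = {U. open U \<and> emeasure M U = 0}"
  obtain \<V> where \<V>: "\<V> \<subseteq> \<U>" "countable \<V>" "\<Union>\<V> = \<Union>\<U>"
    using Lindelof[of \<U>] unfolding \<U>_def by blast
  have "(\<Union>U\<in>\<V>. U) \<in> null_sets M"
    using \<V>(1,2) by (intro null_sets_UN') (auto simp: \<U>_def null_sets_def)
  then have "AE x in M. x \<notin> \<Union>\<U>"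
    using \<V>(3) by (auto dest: AE_not_in)
  then show ?thesis
    by (rule AE_mp) (auto simp: measure_support_def \<U>_def zero_less_iff_neq_zero)
qed

context real_distribution
begin

lemma prob_UNIV: "prob UNIV = 1"
  using prob_space by simp

lemma AE_le_upper_B:
  assumes "bdd_above (measure_support M)"
  shows "AE x in M. x \<le> upper_B M"
  using AE_in_measure_support
proof (rule AE_mp, intro AE_I2 impI)
  fix x assume "x \<in> measure_support M"
  then show "x \<le> upper_B M"
    using cSup_upper[OF _ assms] by (fastforce simp: upper_B_def)
qed

section \<open>The Cauchy transform beyond an almost sure upper bound\<close>

context
  fixes B :: real
  assumes AE_le: "AE x in M. x \<le> B"
begin

lemma integrable_inverse_diff:
  assumes "B < z"
  shows "integrable M (\<lambda>x. 1 / (z - x))"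
proof (rule integrable_const_bound[where B = "1 / (z - B)"])
  show "AE x in M. norm (1 / (z - x)) \<le> 1 / (z - B)"
    using AE_le by eventually_elim (use assms in \<open>auto intro!: divide_left_mono mult_pos_pos\<close>)
qed simp

lemma cauchy_transform_pos:
  assumes "B < z"
  shows "0 < cauchy_transform M z"
proof -
  have AE: "AE x in M. 0 < 1 / (z - x)"
    using AE_le by eventually_elim (use assms in auto)
  then have "0 \<le> cauchy_transform M z"
    unfolding cauchy_transform_def by (intro integral_nonneg_AE) (auto elim: eventually_mono)
  moreover have "cauchy_transform M z \<noteq> 0"
  proof
    assume "cauchy_transform M z = 0"
    then have "AE x in M. 1 / (z - x) = 0"
      unfolding cauchy_transform_def
      by (subst (asm) integral_nonneg_eq_0_iff_AE[OF integrable_inverse_diff[OF assms]])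
        (use AE in \<open>auto elim: eventually_mono\<close>)
    with AE have "AE x in M. False"
      by eventually_elim auto
    then show False
      by simp
  qed
  ultimately show ?thesis
    by simp
qed

lemma cauchy_transform_le:
  assumes "B < z"
  shows "cauchy_transform M z \<le> 1 / (z - B)"
proof -
  have "cauchy_transform M z \<le> (LINT x|M. 1 / (z - B))"
    unfolding cauchy_transform_def
  proof (rule integral_mono_AE[OF integrable_inverse_diff[OF assms]])
    show "AE x in M. 1 / (z - x) \<le> 1 / (z - B)"
      using AE_le by eventually_elim (use assms in \<open>auto intro!: divide_left_mono mult_pos_pos\<close>)
  qed simp
  then show ?thesis
    by (simp add: prob_UNIV)
qed

text \<open>Yields both monotonicities at once: the left side is positive, and rearranging shows
  that \<open>z - 1 / G(z)\<close> decreases in \<open>z\<close>.\<close>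

lemma inverse_cauchy_transform_diff:
  assumes "B < z" "z < w"
  shows "w - z \<le> 1 / cauchy_transform M w - 1 / cauchy_transform M z"
proof -
  define G where "G = cauchy_transform M z"
  define H where "H = cauchy_transform M w"
  \<comment> \<open>The point where the kernel \<open>1 / (z - x)\<close> takes its mean value
    \<open>G\<close>. The bound on \<open>G\<close> puts it at or below \<open>B\<close>, so both
    kernels are finite and positive there; \<open>k\<close> below is the second kernel at
    \<open>c\<close>.\<close>
  define c where "c = z - 1 / G"
  have pos: "0 < G" "0 < H"
    using cauchy_transform_pos assms by (auto simp: G_def H_def)
  have c: "c \<le> B" "1 / (z - c) = G"
    using cauchy_transform_le[of z] assms pos by (auto simp: c_def G_def field_simps)
  define k where "k = 1 / (w - c)"
  \<comment> \<open>This is \<open>(f(x) - G) * (g(x) - k)\<close> expanded, with the product of the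
    kernels split by partial fractions. Only the integrals of \<open>f\<close> and \<open>g\<close>
    then occur, and the terms in \<open>k\<close> cancel.\<close>
  have "0 \<le> (LINT x|M. (1 / (z - x) - 1 / (w - x)) / (w - z) - G * (1 / (w - x)) - k * (1 / (z - x)) + G * k)"
  proof (rule integral_nonneg_AE)
    txt \<open>Since \<open>f(c) = \<integral> f d\<nu>\<close>, integrating \<open>(f(x) - f(c)) (g(x) - g(c)) \<ge> 0\<close> is enough;
      no product measure is needed.\<close>
    show "AE x in M. 0 \<le> (1 / (z - x) - 1 / (w - x)) / (w - z) - G * (1 / (w - x)) - k * (1 / (z - x)) + G * k"
      using AE_le
    proof eventually_elim
      case (elim x)
      have p: "0 < z - x" "0 < w - x" "0 < z - c" "0 < w - c" "0 < w - z"
        using elim assms c by auto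
      have "(1 / (z - x) - 1 / (w - x)) / (w - z) = (1 / (z - x)) * (1 / (w - x))"
        using p by (simp add: divide_simps)
      then have "(1 / (z - x) - 1 / (w - x)) / (w - z) - G * (1 / (w - x)) - k * (1 / (z - x)) + G * k
          = (1 / (z - x) - 1 / (z - c)) * (1 / (w - x) - 1 / (w - c))"
        by (simp add: c(2) k_def algebra_simps)
      also have "1 / (z - x) - 1 / (z - c) = (x - c) / ((z - x) * (z - c))"
        using p by (simp add: divide_simps)
      also have "1 / (w - x) - 1 / (w - c) = (x - c) / ((w - x) * (w - c))"
        using p by (simp add: divide_simps)
      also have "(x - c) / ((z - x) * (z - c)) * ((x - c) / ((w - x) * (w - c))) \<ge> 0"
        using p by (simp add: zero_le_divide_iff zero_le_mult_iff)
      finally show ?case .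
    qed
  qed
  also have "\<dots> = (G - H) / (w - z) - G * H - k * G + G * k"
  proof -
    define f g where "f x = 1 / (z - x)" and "g x = 1 / (w - x)" for x
    have "integrable M f" "integrable M g" "G = expectation f" "H = expectation g"
      using integrable_inverse_diff assms
      by (simp_all add: f_def[abs_def] g_def[abs_def] G_def H_def cauchy_transform_def)
    then show ?thesis
      by (simp add: prob_UNIV flip: f_def g_def)
  qed
  finally have "G * H * (w - z) \<le> G - H"
    using assms by (simp add: field_simps)
  then show ?thesis
    using pos by (simp add: field_simps flip: G_def H_def)
qed

lemma csk_mean_eq:
  assumes "0 < \<theta>" "B < 1 / \<theta>"
  shows "csk_mean M \<theta> = 1 / \<theta> - 1 / cauchy_transform M (1 / \<theta>)"
proof -
  define z where "z = 1 / \<theta>"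
  define G where "G = cauchy_transform M z"
  have z: "0 < z" "B < z" "\<theta> = 1 / z"
    using assms by (auto simp: z_def)
  have G: "0 < G"
    using cauchy_transform_pos z by (simp add: G_def)
  have diff: "1 - \<theta> * x = (z - x) / z" for x
    using z by (simp add: field_simps)
  have kernel: "1 / (1 - \<theta> * x) = z * (1 / (z - x))" for x
    by (simp add: diff)
  have M: "csk_M M \<theta> = z * G"
    unfolding csk_M_def kernel G_def cauchy_transform_def by (rule integral_mult_right_zero)
  have dens: "1 / (csk_M M \<theta> * (1 - \<theta> * x)) = 1 / (G * (z - x))" for x
    unfolding M diff using z(1) by simp
  have "csk_mean M \<theta> = (LINT x|M. (1 / (G * (z - x))) *\<^sub>R x)"
    unfolding csk_mean_def csk_measure_def dens
  proof (rule integral_density)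
    show "AE x in M. 0 \<le> 1 / (G * (z - x))"
      using AE_le by eventually_elim (use z G in auto)
  qed auto
  also have "\<dots> = (LINT x|M. z / G * (1 / (z - x)) - 1 / G)"
  proof (rule integral_cong_AE)
    show "AE x in M. (1 / (G * (z - x))) *\<^sub>R x = z / G * (1 / (z - x)) - 1 / G"
      using AE_le by eventually_elim (use z G in \<open>auto simp: field_simps\<close>)
  qed auto
  also have "\<dots> = z / G * G - 1 / G"
  proof -
    define f where "f x = 1 / (z - x)" for x
    have "integrable M f" "G = expectation f"
      using integrable_inverse_diff[OF z(2)] by (simp_all add: f_def[abs_def] G_def cauchy_transform_def)
    then show ?thesis
      by (simp add: prob_UNIV flip: f_def)
  qed
  finally show ?thesis
    using G by (simp add: z_def G_def)
qed

end

end

section \<open>The change of parameter \<open>z = 1 / \<theta>\<close>\<close>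

lemma upper_B_nonneg: "0 \<le> upper_B \<nu>"
  by (simp add: upper_B_def)

text \<open>Writing the upper constraint through \<open>1 / \<theta>\<close> treats finite and
  infinite \<open>theta_plus\<close> alike: for \<open>upper_B \<nu> = 0\<close> it just follows
  from positivity of \<open>\<theta>\<close>.\<close>

lemma einterval_theta_plus:
  "einterval 0 (theta_plus \<nu>) = {\<theta>. 0 < \<theta> \<and> upper_B \<nu> < 1 / \<theta>}"
  using upper_B_nonneg[of \<nu>]
  by (auto simp: einterval_def theta_plus_eq field_simps zero_ereal_def)

lemma image_einterval_theta_plus:
  "(\<lambda>\<theta>. 1 / \<theta>) ` einterval 0 (theta_plus \<nu>) = {upper_B \<nu><..}"
  unfolding einterval_theta_plus
proof (intro equalityI subsetI)
  fix z assume "z \<in> {upper_B \<nu><..}"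
  then show "z \<in> (\<lambda>\<theta>. 1 / \<theta>) ` {\<theta>. 0 < \<theta> \<and> upper_B \<nu> < 1 / \<theta>}"
    using upper_B_nonneg[of \<nu>] by (intro image_eqI[of _ _ "1 / z"]) auto
qed auto

theorem proposition3p4:
  fixes \<nu> :: "real measure"
  assumes "real_distribution \<nu>"
    and "non_degenerate \<nu>"
    and "bdd_above (measure_support \<nu>)"
  shows "\<exists>L::real. L \<ge> 0 \<and>
    ((\<lambda>z. 1 / cauchy_transform \<nu> z) \<longlongrightarrow> L) (at_right (upper_B \<nu>)) \<and>
    m_plus \<nu> = ereal (upper_B \<nu> - L)"
proof -
  interpret real_distribution \<nu> by fact
  define B where "B = upper_B \<nu>"
  define F where "F z = 1 / cauchy_transform \<nu> z" for z
  define L where "L = Inf (F ` {B<..})"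
  note AE = AE_le_upper_B[OF assms(3), folded B_def]
  have F_pos: "0 < F z" if "B < z" for z
    using cauchy_transform_pos[OF AE that] by (simp add: F_def)
  have F_diff: "w - z \<le> F w - F z" if "B < z" "z \<le> w" for z w
    using inverse_cauchy_transform_diff[OF AE that(1)] that by (cases "z = w") (auto simp: F_def)
  have L_nonneg: "0 \<le> L"
    unfolding L_def using F_pos by (intro cINF_greatest) (auto intro: less_imp_le)
  have lim: "(F \<longlongrightarrow> L) (at_right B)"
    unfolding L_def
  proof (rule tendsto_at_right_Inf)
    show "F x \<le> F y" if "B < x" "x \<le> y" for x y
      using F_diff[OF that] that by simp
    show "bdd_below (F ` {B<..})"
      using F_pos by (intro bdd_belowI[of _ 0]) (auto intro: less_imp_le)
  qed
  then have lim_mean: "((\<lambda>z. z - F z) \<longlongrightarrow> B - L) (at_right B)"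
    by (intro tendsto_intros)
  have "domain_of_means \<nu> = (\<lambda>z. z - F z) ` (\<lambda>\<theta>. 1 / \<theta>) ` einterval 0 (theta_plus \<nu>)"
    unfolding domain_of_means_def image_image
    by (intro image_cong refl)
      (auto simp: einterval_theta_plus F_def B_def intro!: csk_mean_eq[OF AE])
  then have dom: "domain_of_means \<nu> = (\<lambda>z. z - F z) ` {B<..}"
    by (simp add: image_einterval_theta_plus B_def)
  have "m_plus \<nu> = ereal (B - L)"
    unfolding m_plus_def dom
  proof (rule Sup_eqI)
    fix y assume "y \<in> ereal ` (\<lambda>z. z - F z) ` {B<..}"
    then obtain z where z: "B < z" "y = ereal (z - F z)"
      by auto
    \<comment> \<open>The means grow as \<open>w\<close> decreases from \<open>z\<close> to
      \<open>B\<close>, so each mean lies below the limit.\<close>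
    have "\<forall>\<^sub>F w in at_right B. z - F z \<le> w - F w"
      unfolding eventually_at_right_field using F_diff[of _ z] z(1) by (intro exI[of _ z]) fastforce
    then have "z - F z \<le> B - L"
      by (intro tendsto_lowerbound[OF lim_mean]) auto
    then show "y \<le> ereal (B - L)"
      using z by simp
  next
    fix y assume y: "\<And>x. x \<in> ereal ` (\<lambda>z. z - F z) ` {B<..} \<Longrightarrow> x \<le> y"
    have "\<forall>\<^sub>F z in at_right B. ereal (z - F z) \<le> y"
      unfolding eventually_at_right_field using y by (intro exI[of _ "B + 1"]) auto
    \<comment> \<open>The upper bound \<open>y\<close> may be infinite, so the comparison with the
      limit is made in the extended reals.\<close>
    moreover have "((\<lambda>z. ereal (z - F z)) \<longlongrightarrow> ereal (B - L)) (at_right B)"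
      using lim_mean by (intro tendsto_ereal)
    ultimately show "ereal (B - L) \<le> y"
      by (intro tendsto_upperbound) auto
  qed
  with L_nonneg lim show ?thesis
    unfolding F_def B_def by blast
qed

end
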